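(* Let $\theta\in\mathbb R$. For all $\mu,\nu,\iota,\lambda\in\mathbb P_\varepsilon$, multiplication in ${}^*\mathbb Z$ defines an action $${}^*\mathbb Z^{\nu[\iota]}\times{}^*\mathbb Z^{\mu[\lambda]}_{\nu}(\theta)\longrightarrow{}^*\mathbb Z^{\mu\cdot\nu[\iota\cdot\lambda]}_{\iota}(\theta),\qquad (a,n)\mapsto an,$$ (i.e. $an$ belongs to the target group whenever $a\in{}^*\mathbb Z^{\nu[\iota]}$ and $n\in{}^*\mathbb Z^{\mu[\lambda]}_\nu(\theta)$), in which $(an)^\perp=a\,n^\perp$.
   Context: Fix a nonprincipal ultrafilter $\mathfrak u$ on $\mathbb N$, and let ${}^*\mathbb Z\subset{}^*\mathbb R$ be the ultrapowers of $\mathbb Z\subset\mathbb R$. Let ${}^*\mathbb R_{\rm fin}$ be the ring of bounded elements, ${}^*\mathbb R_\varepsilon$ its ideal of infinitesimals, and $({}^*\mathbb R_{\rm fin})^\times_+$ the multiplicative group of positive elements that are neither infinite nor infinitesimal. Let $\mathbb P:=({}^*\mathbb R_{>0}\cup\{0\})/({}^*\mathbb R_{\rm fin})^\times_+$; write $\langle x\rangle\in\mathbb P$ for the class of $|x|$, $x\in{}^*\mathbb R$, and $-\infty:=\langle0\rangle$. $\mathbb P$ has the induced product and total order ($\mu<\mu'$ iff $x<x'$ for all representatives $x\in\mu$, $x'\in\mu'$; $-\infty$ is the minimum), and for $n\in{}^*\mathbb Z$ we write $|n|\cdot\mu:=\langle n\rangle\cdot\mu$. $\mathbb P_\varepsilon\subset\mathbb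 P$ is the set of classes of positive infinitesimals. For $\mu,\iota\in\mathbb P_\varepsilon$: ${}^*\mathbb Z^{\mu[\iota]}:=\{n\in{}^*\mathbb Z: |n|\cdot\mu<\iota\}$, a group. For $\theta\in\mathbb R$, ${}^*\mathbb Z(\theta)$ is the group of $n\in{}^*\mathbb Z$ for which there is $n^\perp\in{}^*\mathbb Z$ (necessarily unique, called the dual of $n$) with $\varepsilon(n):=n\theta-n^\perp\in{}^*\mathbb R_\varepsilon$. For $\nu\in\mathbb P_\varepsilon$, ${}^*\mathbb Z_\nu(\theta):=\{n\in{}^*\mathbb Z(\theta):\langle\varepsilon(n)\rangle\le\nu\}$, and ${}^*\mathbb Z^{\mu[\iota]}_\nu(\theta):={}^*\mathbb Z^{\mu[\iota]}\cap{}^*\mathbb Z_\nu(\theta)$. *)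

theory Defs
  imports Complex_Main
begin

section \<open>Hyperreals over an arbitrary nonprincipal ultrafilter\<close>

definition nonprincipal_ultrafilter :: "nat filter \<Rightarrow> bool" where
  "nonprincipal_ultrafilter U \<longleftrightarrow>
     U \<noteq> bot \<and>
     (\<forall>P. eventually P U \<or> eventually (\<lambda>i. \<not> P i) U) \<and>
     (\<forall>i. U \<noteq> principal {i})"

text \<open>
  The ultrafilter is a parameter of everything below, so the ultrapower is not a type: a
  hyperreal is an equivalence class of real sequences, and \<open>hyp U x\<close> is the class of \<open>x\<close>.
\<close>

type_synonym hyper = "(nat \<Rightarrow> real) set"

definition hyp_rel :: "nat filter \<Rightarrow> ((nat \<Rightarrow> real) \<times> (nat \<Rightarrow> real)) set" where
  "hyp_rel U = {(x, y). \<forall>\<^sub>F i in U. x i = y i}"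

definition hyp :: "nat filter \<Rightarrow> (nat \<Rightarrow> real) \<Rightarrow> hyper" where
  "hyp U x = hyp_rel U `` {x}"

definition hreals :: "nat filter \<Rightarrow> hyper set" where
  "hreals U = UNIV // hyp_rel U"

text \<open>The ultrapower of the integers, as a subset of the ultrapower of the reals.\<close>

definition hints :: "nat filter \<Rightarrow> hyper set" where
  "hints U = {hyp U (\<lambda>i. of_int (k i)) |k :: nat \<Rightarrow> int. True}"

definition hconst :: "nat filter \<Rightarrow> real \<Rightarrow> hyper" where
  "hconst U r = hyp U (\<lambda>_. r)"

definition hmul :: "nat filter \<Rightarrow> hyper \<Rightarrow> hyper \<Rightarrow> hyper" where
  "hmul U X Y = {z. \<exists>x\<in>X. \<exists>y\<in>Y. \<forall>\<^sub>F i in U. z i = x i * y i}"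

definition hdiff :: "nat filter \<Rightarrow> hyper \<Rightarrow> hyper \<Rightarrow> hyper" where
  "hdiff U X Y = {z. \<exists>x\<in>X. \<exists>y\<in>Y. \<forall>\<^sub>F i in U. z i = x i - y i}"

definition habs :: "nat filter \<Rightarrow> hyper \<Rightarrow> hyper" where
  "habs U X = {z. \<exists>x\<in>X. \<forall>\<^sub>F i in U. z i = \<bar>x i\<bar>}"

definition hless :: "nat filter \<Rightarrow> hyper \<Rightarrow> hyper \<Rightarrow> bool" where
  "hless U X Y \<longleftrightarrow> (\<exists>x\<in>X. \<exists>y\<in>Y. \<forall>\<^sub>F i in U. x i < y i)"

definition hfin :: "nat filter \<Rightarrow> hyper set" where
  "hfin U = {X \<in> hreals U. \<exists>r. hless U (habs U X) (hconst U r)}"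

definition hinfinitesimal :: "nat filter \<Rightarrow> hyper set" where
  "hinfinitesimal U = {X \<in> hreals U. \<forall>r>0. hless U (habs U X) (hconst U r)}"

definition hfin_units_pos :: "nat filter \<Rightarrow> hyper set" where
  "hfin_units_pos U = {X \<in> hfin U. hless U (hconst U 0) X \<and> X \<notin> hinfinitesimal U}"


section \<open>Growth-decay classes\<close>

text \<open>
  \<open>cls U X\<close> is the class of \<open>\<bar>X\<bar>\<close> modulo \<open>hfin_units_pos U\<close>, that is, the orbit of \<open>\<bar>X\<bar>\<close> under
  multiplication; in particular \<open>cls U (hconst U 0)\<close>, the class written as minus infinity, is
  the singleton of zero. Products of classes are products of orbits (see \<open>cmul_cls\<close>).
\<close>

definition cls :: "nat filter \<Rightarrow> hyper \<Rightarrow> hyper set" where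
  "cls U X = (\<lambda>G. hmul U G (habs U X)) ` hfin_units_pos U"

definition cmul :: "nat filter \<Rightarrow> hyper set \<Rightarrow> hyper set \<Rightarrow> hyper set" where
  "cmul U \<mu> \<nu> = {hmul U X Y |X Y. X \<in> \<mu> \<and> Y \<in> \<nu>}"

definition cless :: "nat filter \<Rightarrow> hyper set \<Rightarrow> hyper set \<Rightarrow> bool" where
  "cless U \<mu> \<nu> \<longleftrightarrow> (\<forall>X\<in>\<mu>. \<forall>Y\<in>\<nu>. hless U X Y)"

definition cle :: "nat filter \<Rightarrow> hyper set \<Rightarrow> hyper set \<Rightarrow> bool" where
  "cle U \<mu> \<nu> \<longleftrightarrow> cless U \<mu> \<nu> \<or> \<mu> = \<nu>"

definition PP :: "nat filter \<Rightarrow> hyper set set" where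
  "PP U = {cls U X |X. X \<in> hreals U \<and> (hless U (hconst U 0) X \<or> X = hconst U 0)}"

definition PP_eps :: "nat filter \<Rightarrow> hyper set set" where
  "PP_eps U = {cls U X |X. X \<in> hinfinitesimal U \<and> hless U (hconst U 0) X}"


section \<open>Groups of diophantine approximations\<close>

definition hints_growth :: "nat filter \<Rightarrow> hyper set \<Rightarrow> hyper set \<Rightarrow> hyper set" where
  "hints_growth U \<mu> \<iota> = {n \<in> hints U. cless U (cmul U (cls U n) \<mu>) \<iota>}"

definition is_dual :: "nat filter \<Rightarrow> real \<Rightarrow> hyper \<Rightarrow> hyper \<Rightarrow> bool" where
  "is_dual U \<theta> n m \<longleftrightarrow>
     m \<in> hints U \<and> hdiff U (hmul U n (hconst U \<theta>)) m \<in> hinfinitesimal U"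

definition hints_approx :: "nat filter \<Rightarrow> real \<Rightarrow> hyper set" where
  "hints_approx U \<theta> = {n \<in> hints U. \<exists>m. is_dual U \<theta> n m}"

definition dual :: "nat filter \<Rightarrow> real \<Rightarrow> hyper \<Rightarrow> hyper" where
  "dual U \<theta> n = (THE m. is_dual U \<theta> n m)"

definition err :: "nat filter \<Rightarrow> real \<Rightarrow> hyper \<Rightarrow> hyper" where
  "err U \<theta> n = hdiff U (hmul U n (hconst U \<theta>)) (dual U \<theta> n)"

definition hints_decay :: "nat filter \<Rightarrow> real \<Rightarrow> hyper set \<Rightarrow> hyper set" where
  "hints_decay U \<theta> \<nu> = {n \<in> hints_approx U \<theta>. cle U (cls U (err U \<theta> n)) \<nu>}"

definition hints_growth_decay ::
  "nat filter \<Rightarrow> real \<Rightarrow> hyper set \<Rightarrow> hyper set \<Rightarrow> hyper set \<Rightarrow> hyper set" where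
  "hints_growth_decay U \<theta> \<mu> \<iota> \<nu> = hints_growth U \<mu> \<iota> \<inter> hints_decay U \<theta> \<nu>"


section \<open>Basic facts\<close>

lemma hyp_iff: "y \<in> hyp U x \<longleftrightarrow> (\<forall>\<^sub>F i in U. x i = y i)"
  by (simp add: hyp_def hyp_rel_def)

lemma hyp_self: "x \<in> hyp U x"
  by (simp add: hyp_iff)

lemma hyp_eq_iff: "hyp U x = hyp U y \<longleftrightarrow> (\<forall>\<^sub>F i in U. x i = y i)"
proof
  assume "hyp U x = hyp U y"
  then have "y \<in> hyp U x" by (simp add: hyp_self)
  then show "\<forall>\<^sub>F i in U. x i = y i" by (simp add: hyp_iff)
next
  assume *: "\<forall>\<^sub>F i in U. x i = y i"
  show "hyp U x = hyp U y"
    by (rule set_eqI, unfold hyp_iff, rule iffI) (use * in \<open>auto elim: eventually_elim2\<close>)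
qed

lemma hreals_hyp [simp]: "hyp U x \<in> hreals U"
  by (auto simp: hreals_def hyp_def intro: quotientI)

lemma hrealsE: assumes "X \<in> hreals U" obtains x where "X = hyp U x"
  using assms by (auto simp: hreals_def hyp_def elim: quotientE)

lemma hmul_hyp: "hmul U (hyp U x) (hyp U y) = hyp U (\<lambda>i. x i * y i)"
proof (rule set_eqI, rule iffI)
  fix z assume "z \<in> hmul U (hyp U x) (hyp U y)"
  then obtain a b where "\<forall>\<^sub>F i in U. x i = a i" "\<forall>\<^sub>F i in U. y i = b i" "\<forall>\<^sub>F i in U. z i = a i * b i"
    by (auto simp: hmul_def hyp_iff)
  then show "z \<in> hyp U (\<lambda>i. x i * y i)"
    unfolding hyp_iff by eventually_elim simp
next
  fix z assume "z \<in> hyp U (\<lambda>i. x i * y i)"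
  then have "\<forall>\<^sub>F i in U. z i = x i * y i" unfolding hyp_iff by eventually_elim simp
  then show "z \<in> hmul U (hyp U x) (hyp U y)" unfolding hmul_def using hyp_self by blast
qed

lemma hdiff_hyp: "hdiff U (hyp U x) (hyp U y) = hyp U (\<lambda>i. x i - y i)"
proof (rule set_eqI, rule iffI)
  fix z assume "z \<in> hdiff U (hyp U x) (hyp U y)"
  then obtain a b where "\<forall>\<^sub>F i in U. x i = a i" "\<forall>\<^sub>F i in U. y i = b i" "\<forall>\<^sub>F i in U. z i = a i - b i"
    by (auto simp: hdiff_def hyp_iff)
  then show "z \<in> hyp U (\<lambda>i. x i - y i)"
    unfolding hyp_iff by eventually_elim simp
next
  fix z assume "z \<in> hyp U (\<lambda>i. x i - y i)"
  then have "\<forall>\<^sub>F i in U. z i = x i - y i" unfolding hyp_iff by eventually_elim simp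
  then show "z \<in> hdiff U (hyp U x) (hyp U y)" unfolding hdiff_def using hyp_self by blast
qed

lemma habs_hyp: "habs U (hyp U x) = hyp U (\<lambda>i. \<bar>x i\<bar>)"
proof (rule set_eqI, rule iffI)
  fix z assume "z \<in> habs U (hyp U x)"
  then obtain a where "\<forall>\<^sub>F i in U. x i = a i" "\<forall>\<^sub>F i in U. z i = \<bar>a i\<bar>"
    by (auto simp: habs_def hyp_iff)
  then show "z \<in> hyp U (\<lambda>i. \<bar>x i\<bar>)"
    unfolding hyp_iff by eventually_elim simp
next
  fix z assume "z \<in> hyp U (\<lambda>i. \<bar>x i\<bar>)"
  then have "\<forall>\<^sub>F i in U. z i = \<bar>x i\<bar>" unfolding hyp_iff by eventually_elim simp
  then show "z \<in> habs U (hyp U x)" unfolding habs_def using hyp_self by blast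
qed

lemma hless_hyp: "hless U (hyp U x) (hyp U y) \<longleftrightarrow> (\<forall>\<^sub>F i in U. x i < y i)"
proof
  assume "hless U (hyp U x) (hyp U y)"
  then obtain a b where "\<forall>\<^sub>F i in U. x i = a i" "\<forall>\<^sub>F i in U. y i = b i" "\<forall>\<^sub>F i in U. a i < b i"
    by (auto simp: hless_def hyp_iff)
  then show "\<forall>\<^sub>F i in U. x i < y i" by eventually_elim simp
next
  assume "\<forall>\<^sub>F i in U. x i < y i"
  then show "hless U (hyp U x) (hyp U y)" unfolding hless_def using hyp_self by blast
qed

lemmas hyp_simps = hmul_hyp hdiff_hyp habs_hyp hless_hyp hconst_def

lemma hinfinitesimal_hyp:
  "hyp U x \<in> hinfinitesimal U \<longleftrightarrow> (\<forall>r>0. \<forall>\<^sub>F i in U. \<bar>x i\<bar> < r)"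
  by (simp add: hinfinitesimal_def hyp_simps)

lemma hfin_units_pos_hyp:
  assumes "nonprincipal_ultrafilter U"
  shows "hyp U x \<in> hfin_units_pos U \<longleftrightarrow> (\<exists>e>0. \<exists>r. \<forall>\<^sub>F i in U. e \<le> x i \<and> x i < r)"
proof
  assume "hyp U x \<in> hfin_units_pos U"
  then obtain r e where r: "\<forall>\<^sub>F i in U. \<bar>x i\<bar> < r" and p: "\<forall>\<^sub>F i in U. 0 < x i"
    and e: "e > 0" "\<not> (\<forall>\<^sub>F i in U. \<bar>x i\<bar> < e)"
    by (auto simp: hfin_units_pos_def hfin_def hinfinitesimal_hyp hyp_simps)
  have "\<forall>\<^sub>F i in U. \<not> \<bar>x i\<bar> < e"
    using assms e(2) unfolding nonprincipal_ultrafilter_def by blast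
  with r p have "\<forall>\<^sub>F i in U. e \<le> x i \<and> x i < r" by eventually_elim auto
  with e(1) show "\<exists>e>0. \<exists>r. \<forall>\<^sub>F i in U. e \<le> x i \<and> x i < r" by blast
next
  assume "\<exists>e>0. \<exists>r. \<forall>\<^sub>F i in U. e \<le> x i \<and> x i < r"
  then obtain e r where e: "e > 0" and *: "\<forall>\<^sub>F i in U. e \<le> x i \<and> x i < r" by blast
  have 1: "\<forall>\<^sub>F i in U. \<bar>x i\<bar> < r" and 2: "\<forall>\<^sub>F i in U. 0 < x i"
    using * e by (auto elim!: eventually_mono)
  have "\<not> (\<forall>\<^sub>F i in U. \<bar>x i\<bar> < e)"
  proof
    assume "\<forall>\<^sub>F i in U. \<bar>x i\<bar> < e"
    with * have "\<forall>\<^sub>F i in U. False" by eventually_elim auto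
    with assms show False by (auto simp: nonprincipal_ultrafilter_def trivial_limit_def)
  qed
  with 1 2 e show "hyp U x \<in> hfin_units_pos U"
    by (auto simp: hfin_units_pos_def hfin_def hinfinitesimal_hyp hyp_simps)
qed

lemma hfin_units_posE:
  assumes "nonprincipal_ultrafilter U" "G \<in> hfin_units_pos U"
  obtains g e r where "G = hyp U g" "e > 0" "\<forall>\<^sub>F i in U. e \<le> g i \<and> g i < r"
proof -
  obtain g where "G = hyp U g"
    using assms(2) by (auto simp: hfin_units_pos_def hfin_def elim: hrealsE)
  with assms that show thesis by (auto simp: hfin_units_pos_hyp)
qed

lemma hfin_units_pos_mul:
  assumes U: "nonprincipal_ultrafilter U" and G: "G \<in> hfin_units_pos U" and H: "H \<in> hfin_units_pos U"
  shows "hmul U G H \<in> hfin_units_pos U"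
proof -
  obtain g e r where g: "G = hyp U g" "e > 0" "\<forall>\<^sub>F i in U. e \<le> g i \<and> g i < r"
    using hfin_units_posE[OF U G] .
  obtain h d s where h: "H = hyp U h" "d > 0" "\<forall>\<^sub>F i in U. d \<le> h i \<and> h i < s"
    using hfin_units_posE[OF U H] .
  have "\<forall>\<^sub>F i in U. e * d \<le> g i * h i \<and> g i * h i < r * s"
    using g(3) h(3)
  proof eventually_elim
    case (elim i)
    with g(2) h(2) show ?case by (auto intro!: mult_mono mult_strict_mono)
  qed
  moreover have "e * d > 0" using g(2) h(2) by simp
  ultimately show ?thesis unfolding g(1) h(1) hmul_hyp hfin_units_pos_hyp[OF U] by blast
qed

lemma hfin_units_pos_one:
  assumes U: "nonprincipal_ultrafilter U"
  shows "hyp U (\<lambda>_. 1) \<in> hfin_units_pos U"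
  unfolding hfin_units_pos_hyp[OF U] by (intro exI[of _ 1] conjI exI[of _ 2]) auto

lemma cmul_cls:
  assumes U: "nonprincipal_ultrafilter U" and "X \<in> hreals U" "Y \<in> hreals U"
  shows "cmul U (cls U X) (cls U Y) = cls U (hmul U X Y)"
proof -
  obtain x y where X: "X = hyp U x" and Y: "Y = hyp U y" using assms by (metis hrealsE)
  have eq: "hmul U (hmul U G (habs U X)) (hmul U H (habs U Y))
      = hmul U (hmul U G H) (habs U (hmul U X Y))"
    if "G \<in> hfin_units_pos U" "H \<in> hfin_units_pos U" for G H
    using that by (auto elim!: hfin_units_posE[OF U] simp: X Y hyp_simps abs_mult algebra_simps)
  show ?thesis
  proof (intro set_eqI iffI)
    fix Z assume "Z \<in> cmul U (cls U X) (cls U Y)"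
    then obtain G H where "G \<in> hfin_units_pos U" "H \<in> hfin_units_pos U"
      and "Z = hmul U (hmul U G (habs U X)) (hmul U H (habs U Y))"
      by (auto simp: cmul_def cls_def)
    then show "Z \<in> cls U (hmul U X Y)"
      by (auto simp: eq cls_def intro: hfin_units_pos_mul[OF U])
  next
    fix Z assume "Z \<in> cls U (hmul U X Y)"
    then obtain G where G: "G \<in> hfin_units_pos U" and Z: "Z = hmul U G (habs U (hmul U X Y))"
      by (auto simp: cls_def)
    let ?I = "hyp U (\<lambda>_. 1)"
    have "hmul U G ?I = G" using G by (auto elim!: hfin_units_posE[OF U] simp: hyp_simps)
    with eq[OF G hfin_units_pos_one[OF U]] Z
    have "Z = hmul U (hmul U G (habs U X)) (hmul U ?I (habs U Y))" by simp
    with G hfin_units_pos_one[OF U] show "Z \<in> cmul U (cls U X) (cls U Y)"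
      unfolding cmul_def cls_def by blast
  qed
qed

lemma is_dual_unique:
  assumes U: "nonprincipal_ultrafilter U" and n: "n \<in> hints U"
    and m: "is_dual U \<theta> n m" and m': "is_dual U \<theta> n m'"
  shows "m = m'"
proof -
  obtain a b c where n: "n = hyp U (\<lambda>i. of_int (a i))" and b: "m = hyp U (\<lambda>i. of_int (b i))"
    and c: "m' = hyp U (\<lambda>i. of_int (c i))"
    using n m m' by (auto simp: hints_def is_dual_def)
  have "\<forall>\<^sub>F i in U. \<bar>of_int (a i) * \<theta> - of_int (b i)\<bar> < 1/2"
       "\<forall>\<^sub>F i in U. \<bar>of_int (a i) * \<theta> - of_int (c i)\<bar> < 1/2"
    using m m' half_gt_zero[OF zero_less_one]
    unfolding is_dual_def n b c hyp_simps hinfinitesimal_hyp by blast+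
  then have "\<forall>\<^sub>F i in U. (of_int (b i) :: real) = of_int (c i)"
  proof eventually_elim
    case (elim i)
    then have "\<bar>of_int (b i) - of_int (c i) :: real\<bar> < 1" by linarith
    then have "real_of_int \<bar>b i - c i\<bar> < 1" by simp
    then show ?case by simp
  qed
  then show ?thesis by (simp add: b c hyp_eq_iff)
qed

lemma dual_eq:
  assumes "nonprincipal_ultrafilter U" "n \<in> hints U" "is_dual U \<theta> n m"
  shows "dual U \<theta> n = m"
  unfolding dual_def
  by (rule the_equality, rule assms(3)) (rule is_dual_unique[OF assms(1,2) _ assms(3)])

lemma PP_eps_subset: "PP_eps U \<subseteq> PP U"
  by (auto simp: PP_eps_def PP_def hinfinitesimal_def)

lemma PP_eps_cmul:
  assumes U: "nonprincipal_ultrafilter U" and "\<mu> \<in> PP_eps U" "\<nu> \<in> PP_eps U"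
  shows "cmul U \<mu> \<nu> \<in> PP_eps U"
proof -
  obtain x y where mu: "\<mu> = cls U (hyp U x)" and nu: "\<nu> = cls U (hyp U y)"
    and x: "hyp U x \<in> hinfinitesimal U" "\<forall>\<^sub>F i in U. 0 < x i"
    and y: "hyp U y \<in> hinfinitesimal U" "\<forall>\<^sub>F i in U. 0 < y i"
    using assms(2,3) by (auto simp: PP_eps_def hinfinitesimal_def hyp_simps elim!: hrealsE)
  have eq: "cmul U \<mu> \<nu> = cls U (hyp U (\<lambda>i. x i * y i))"
    unfolding mu nu by (simp add: cmul_cls[OF U] hmul_hyp)
  have "hyp U (\<lambda>i. x i * y i) \<in> hinfinitesimal U"
    unfolding hinfinitesimal_hyp
  proof (intro allI impI)
    fix r :: real assume "r > 0"
    then have "\<forall>\<^sub>F i in U. \<bar>x i\<bar> < r" "\<forall>\<^sub>F i in U. \<bar>y i\<bar> < 1"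
      using x(1) y(1) by (auto simp: hinfinitesimal_hyp)
    then show "\<forall>\<^sub>F i in U. \<bar>x i * y i\<bar> < r"
    proof eventually_elim
      case (elim i)
      then have "\<bar>x i\<bar> * \<bar>y i\<bar> < r * 1" by (intro mult_strict_mono') auto
      then show ?case by (simp add: abs_mult)
    qed
  qed
  moreover have "\<forall>\<^sub>F i in U. 0 < x i * y i" using x(2) y(2) by eventually_elim simp
  ultimately show ?thesis unfolding eq PP_eps_def by (auto simp: hyp_simps)
qed

end

theory Submission
  imports Defs
begin

text \<open>
  Between classes, \<open>\<langle>x\<rangle> < \<langle>y\<rangle>\<close> means that \<open>C \<bar>x\<bar> < \<bar>y\<bar>\<close> for every standard \<open>C\<close>, and
  \<open>\<langle>x\<rangle> \<le> \<langle>y\<rangle>\<close> implies \<open>\<bar>x\<bar> \<le> C \<bar>y\<bar>\<close> for some standard \<open>C\<close>. Since \<open>(a n) \<theta> - a n\<^sup>\<bottom> = a \<epsilon>(n)\<close> and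
  \<open>\<bar>a \<epsilon>(n)\<bar> \<le> C \<bar>a\<bar> \<nu>\<close>, the growth condition \<open>\<bar>a\<bar> \<nu> < \<iota>\<close> makes this error smaller than \<open>\<iota>\<close>. It is
  thus infinitesimal, so \<open>a n\<^sup>\<bottom>\<close> is the dual of \<open>a n\<close>. The growth bounds simply multiply.
\<close>

text \<open>A positive constant \<open>C\<close> is itself a unit, so
  \<open>C * \<bar>x i\<bar>\<close> represents the class of \<open>x\<close>; this gives the bound
  for every \<open>C\<close>. Conversely, arbitrary representatives carry unit factors
  \<open>g\<close> and \<open>h\<close>, and the upper bound of \<open>g\<close> over the lower
  bound of \<open>h\<close> is one admissible constant.\<close>

lemma cless_cls_hyp:
  assumes U: "nonprincipal_ultrafilter U"
  shows "cless U (cls U (hyp U x)) (cls U (hyp U y)) \<longleftrightarrow>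
    (\<forall>C>0. \<forall>\<^sub>F i in U. C * \<bar>x i\<bar> < \<bar>y i\<bar>)"
proof (intro iffI allI impI)
  fix C :: real assume less: "cless U (cls U (hyp U x)) (cls U (hyp U y))" and C: "C > 0"
  have "hyp U (\<lambda>_. C) \<in> hfin_units_pos U"
    unfolding hfin_units_pos_hyp[OF U]
    by (intro exI[of _ C] conjI exI[of _ "C + 1"]) (use C in auto)
  then have "hless U (hmul U (hyp U (\<lambda>_. C)) (habs U (hyp U x)))
      (hmul U (hyp U (\<lambda>_. 1)) (habs U (hyp U y)))"
    using less hfin_units_pos_one[OF U] unfolding cless_def cls_def by blast
  then show "\<forall>\<^sub>F i in U. C * \<bar>x i\<bar> < \<bar>y i\<bar>" by (simp add: hyp_simps)
next
  assume *: "\<forall>C>0. \<forall>\<^sub>F i in U. C * \<bar>x i\<bar> < \<bar>y i\<bar>"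
  show "cless U (cls U (hyp U x)) (cls U (hyp U y))"
    unfolding cless_def cls_def
  proof (intro ballI; elim imageE; hypsubst)
    fix G H assume G: "G \<in> hfin_units_pos U" and H: "H \<in> hfin_units_pos U"
    obtain g d r where g: "G = hyp U g" "d > 0" "\<forall>\<^sub>F i in U. d \<le> g i \<and> g i < r"
      using hfin_units_posE[OF U G] .
    obtain h e s where h: "H = hyp U h" "e > 0" "\<forall>\<^sub>F i in U. e \<le> h i \<and> h i < s"
      using hfin_units_posE[OF U H] .
    define R where "R = max r 1"
    have "R / e > 0" using h(2) by (simp add: R_def)
    with * have "\<forall>\<^sub>F i in U. R / e * \<bar>x i\<bar> < \<bar>y i\<bar>" by blast
    with g(3) h(3) have "\<forall>\<^sub>F i in U. g i * \<bar>x i\<bar> < h i * \<bar>y i\<bar>"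
    proof eventually_elim
      case (elim i)
      have "g i * \<bar>x i\<bar> \<le> R * \<bar>x i\<bar>"
        using elim by (intro mult_right_mono) (auto simp: R_def)
      also have "\<dots> < e * \<bar>y i\<bar>" using elim h(2) by (simp add: field_simps)
      also have "\<dots> \<le> h i * \<bar>y i\<bar>" using elim by (intro mult_right_mono) auto
      finally show ?case .
    qed
    then show "hless U (hmul U G (habs U (hyp U x))) (hmul U H (habs U (hyp U y)))"
      by (simp add: g h hyp_simps)
  qed
qed

text \<open>In the strict case \<open>C = 1\<close> works. If the classes agree,
  \<open>\<bar>x\<bar>\<close> lies in the orbit of \<open>\<bar>y\<bar>\<close>, and an upper bound
  of the unit relating them serves as \<open>C\<close>.\<close>

lemma cle_cls_hypD:
  assumes U: "nonprincipal_ultrafilter U"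
    and le: "cle U (cls U (hyp U x)) (cls U (hyp U y))"
  obtains C where "C > 0" "\<forall>\<^sub>F i in U. \<bar>x i\<bar> \<le> C * \<bar>y i\<bar>"
  using le unfolding cle_def
proof (elim disjE)
  assume "cless U (cls U (hyp U x)) (cls U (hyp U y))"
  then have "\<forall>\<^sub>F i in U. 1 * \<bar>x i\<bar> < \<bar>y i\<bar>"
    unfolding cless_cls_hyp[OF U] using zero_less_one by blast
  then have "\<forall>\<^sub>F i in U. \<bar>x i\<bar> \<le> 1 * \<bar>y i\<bar>" by eventually_elim simp
  then show thesis by (rule that[OF zero_less_one])
next
  assume eq: "cls U (hyp U x) = cls U (hyp U y)"
  have "hmul U (hyp U (\<lambda>_. 1)) (habs U (hyp U x)) \<in> cls U (hyp U y)"
    unfolding eq[symmetric] unfolding cls_def using hfin_units_pos_one[OF U] by (rule imageI)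
  then obtain G where G: "G \<in> hfin_units_pos U"
    and "hmul U (hyp U (\<lambda>_. 1)) (habs U (hyp U x)) = hmul U G (habs U (hyp U y))"
    unfolding cls_def by blast
  moreover obtain g e r where g: "G = hyp U g" "e > 0" "\<forall>\<^sub>F i in U. e \<le> g i \<and> g i < r"
    using hfin_units_posE[OF U G] .
  ultimately have "\<forall>\<^sub>F i in U. \<bar>x i\<bar> = g i * \<bar>y i\<bar>" by (simp add: hyp_simps hyp_eq_iff)
  with g(3) have "\<forall>\<^sub>F i in U. \<bar>x i\<bar> \<le> max r 1 * \<bar>y i\<bar>"
    by eventually_elim (auto intro!: mult_right_mono)
  then show thesis by (rule that[rotated]) simp
qed

lemma PP_epsE:
  assumes "\<mu> \<in> PP_eps U"
  obtains x where "\<mu> = cls U (hyp U x)" "\<forall>r>0. \<forall>\<^sub>F i in U. \<bar>x i\<bar> < r"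
proof -
  obtain X where X: "\<mu> = cls U X" "X \<in> hinfinitesimal U"
    using assms by (auto simp: PP_eps_def)
  then obtain x where "X = hyp U x" by (auto simp: hinfinitesimal_def elim: hrealsE)
  with X that show thesis by (simp add: hinfinitesimal_hyp)
qed

lemma hints_growth_hyp:
  assumes U: "nonprincipal_ultrafilter U"
  shows "hyp U x \<in> hints_growth U (cls U (hyp U m)) (cls U (hyp U j)) \<longleftrightarrow>
    hyp U x \<in> hints U \<and> (\<forall>C>0. \<forall>\<^sub>F i in U. C * \<bar>x i * m i\<bar> < \<bar>j i\<bar>)"
  by (simp add: hints_growth_def cmul_cls[OF U] hmul_hyp cless_cls_hyp[OF U])

lemma hints_mul:
  assumes "a \<in> hints U" "b \<in> hints U"
  shows "hmul U a b \<in> hints U"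
proof -
  obtain k l where "a = hyp U (\<lambda>i. of_int (k i))" "b = hyp U (\<lambda>i. of_int (l i))"
    using assms by (auto simp: hints_def)
  then have "hmul U a b = hyp U (\<lambda>i. of_int (k i * l i))" by (simp add: hmul_hyp)
  then show ?thesis
    unfolding hints_def by (intro CollectI exI[of _ "\<lambda>i. k i * l i"] conjI TrueI)
qed

lemma hintsE:
  assumes "a \<in> hints U" obtains x where "a = hyp U x"
  using assms by (auto simp: hints_def)

theorem proposition12:
  fixes U :: "nat filter" and \<theta> :: real and \<mu> \<nu> \<iota> \<kappa> :: "hyper set"
  assumes "nonprincipal_ultrafilter U"
    and "\<mu> \<in> PP_eps U" and "\<nu> \<in> PP_eps U" and "\<iota> \<in> PP_eps U" and "\<kappa> \<in> PP_eps U"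
  shows "\<forall>a \<in> hints_growth U \<nu> \<iota>. \<forall>n \<in> hints_growth_decay U \<theta> \<mu> \<kappa> \<nu>.
           hmul U a n \<in> hints_growth_decay U \<theta> (cmul U \<mu> \<nu>) (cmul U \<iota> \<kappa>) \<iota> \<and>
           dual U \<theta> (hmul U a n) = hmul U a (dual U \<theta> n)"
proof (intro ballI)
  note U = assms(1)
  obtain m where mu: "\<mu> = cls U (hyp U m)" using assms(2) by (rule PP_epsE)
  obtain v where nu: "\<nu> = cls U (hyp U v)" using assms(3) by (rule PP_epsE)
  obtain j where iota: "\<iota> = cls U (hyp U j)" and j: "\<forall>r>0. \<forall>\<^sub>F i in U. \<bar>j i\<bar> < r"
    using assms(4) by (rule PP_epsE)
  obtain l where kappa: "\<kappa> = cls U (hyp U l)" using assms(5) by (rule PP_epsE)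
  fix a n assume a: "a \<in> hints_growth U \<nu> \<iota>" and n: "n \<in> hints_growth_decay U \<theta> \<mu> \<kappa> \<nu>"
  have ints: "a \<in> hints U" "n \<in> hints U"
    using a n by (auto simp: hints_growth_def hints_growth_decay_def)
  obtain x where x: "a = hyp U x" using ints(1) by (rule hintsE)
  obtain y where y: "n = hyp U y" using ints(2) by (rule hintsE)
  have an_ints: "hmul U a n \<in> hints U" using ints by (rule hints_mul)

  have a_growth: "\<forall>\<^sub>F i in U. C * \<bar>x i * v i\<bar> < \<bar>j i\<bar>" if "C > 0" for C
    using a that by (simp add: x nu iota hints_growth_hyp[OF U])
  \<comment> \<open>Constant 1 is enough here: in the product of the two growth bounds, the
    arbitrary factor is supplied by \<open>a_growth\<close>.\<close>
  have n_growth: "\<forall>\<^sub>F i in U. 1 * \<bar>y i * m i\<bar> < \<bar>l i\<bar>"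
    using n zero_less_one unfolding hints_growth_decay_def y mu kappa Int_iff hints_growth_hyp[OF U]
    by blast

  obtain p where p: "is_dual U \<theta> n p"
    using n by (auto simp: hints_growth_decay_def hints_decay_def hints_approx_def)
  then have p_ints: "p \<in> hints U" by (simp add: is_dual_def)
  then obtain z where z: "p = hyp U z" by (rule hintsE)
  \<comment> \<open>Replacing the description \<open>dual\<close> by the witness \<open>p\<close>
    gives the error of \<open>n\<close> an explicit representing sequence.\<close>
  have dual_n: "dual U \<theta> n = p" using U ints(2) p by (rule dual_eq)
  have err_n: "err U \<theta> n = hyp U (\<lambda>i. y i * \<theta> - z i)"
    unfolding err_def dual_n by (simp add: y z hyp_simps)
  have "cle U (cls U (err U \<theta> n)) \<nu>"
    using n by (simp add: hints_growth_decay_def hints_decay_def)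
  then have "cle U (cls U (hyp U (\<lambda>i. y i * \<theta> - z i))) (cls U (hyp U v))"
    unfolding err_n nu .
  then obtain C where C: "C > 0" "\<forall>\<^sub>F i in U. \<bar>y i * \<theta> - z i\<bar> \<le> C * \<bar>v i\<bar>"
    by (rule cle_cls_hypD[OF U])

  have diff: "hdiff U (hmul U (hmul U a n) (hconst U \<theta>)) (hmul U a p)
      = hyp U (\<lambda>i. x i * (y i * \<theta> - z i))"
    by (simp add: x y z hyp_simps algebra_simps)
  \<comment> \<open>This serves twice: \<open>D = 1\<close> bounds the error by the infinitesimal
    \<open>j\<close>, and all \<open>D\<close> together give the comparison of classes with
    \<open>\<iota>\<close>.\<close>
  have err_bound: "\<forall>\<^sub>F i in U. D * \<bar>x i * (y i * \<theta> - z i)\<bar> < \<bar>j i\<bar>" if D: "D > 0" for D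
  proof -
    \<comment> \<open>The factor \<open>C\<close> absorbs the loss in passing from the error of
      \<open>n\<close> to \<open>v\<close>.\<close>
    have "\<forall>\<^sub>F i in U. D * C * \<bar>x i * v i\<bar> < \<bar>j i\<bar>" using C(1) D by (intro a_growth) simp
    with C(2) show ?thesis
    proof eventually_elim
      case (elim i)
      have "D * \<bar>x i * (y i * \<theta> - z i)\<bar> = D * \<bar>x i\<bar> * \<bar>y i * \<theta> - z i\<bar>" by (simp add: abs_mult)
      also have "\<dots> \<le> D * \<bar>x i\<bar> * (C * \<bar>v i\<bar>)" using elim D by (intro mult_left_mono) auto
      also have "\<dots> = D * C * \<bar>x i * v i\<bar>" by (simp add: abs_mult)
      finally show ?case using elim by simp
    qed
  qed
  have "hyp U (\<lambda>i. x i * (y i * \<theta> - z i)) \<in> hinfinitesimal U"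
    unfolding hinfinitesimal_hyp
  proof (intro allI impI)
    fix r :: real assume "r > 0"
    then have "\<forall>\<^sub>F i in U. \<bar>j i\<bar> < r" using j by blast
    with err_bound[OF zero_less_one] show "\<forall>\<^sub>F i in U. \<bar>x i * (y i * \<theta> - z i)\<bar> < r"
      by eventually_elim simp
  qed
  then have dual_an: "is_dual U \<theta> (hmul U a n) (hmul U a p)"
    using hints_mul[OF ints(1) p_ints] by (simp add: is_dual_def diff)
  then have dual_eq_an: "dual U \<theta> (hmul U a n) = hmul U a p" by (rule dual_eq[OF U an_ints])

  \<comment> \<open>Since \<open>err\<close> refers to \<open>dual\<close>, the dual of the product
    must be known first. The decay obtained is strict, more than \<open>cle\<close> asks.\<close>
  have "cless U (cls U (err U \<theta> (hmul U a n))) \<iota>"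
    unfolding err_def dual_eq_an diff iota cless_cls_hyp[OF U] using err_bound by blast
  then have decay: "hmul U a n \<in> hints_decay U \<theta> \<iota>"
    using an_ints dual_an by (auto simp: hints_decay_def hints_approx_def cle_def)

  have "\<forall>\<^sub>F i in U. D * \<bar>x i * y i * (m i * v i)\<bar> < \<bar>j i * l i\<bar>" if D: "D > 0" for D
    using a_growth[OF D] n_growth
  proof eventually_elim
    case (elim i)
    \<comment> \<open>The factors are regrouped crosswise, \<open>x\<close> with \<open>v\<close>
      and \<open>y\<close> with \<open>m\<close>, to match the growth conditions on \<open>a\<close>
      and \<open>n\<close>.\<close>
    have "(D * \<bar>x i * v i\<bar>) * (1 * \<bar>y i * m i\<bar>) < \<bar>j i\<bar> * \<bar>l i\<bar>"
      using elim D by (intro mult_strict_mono') auto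
    then show ?case by (simp add: abs_mult mult_ac)
  qed
  then have "hmul U a n \<in> hints_growth U (cmul U \<mu> \<nu>) (cmul U \<iota> \<kappa>)"
    using an_ints by (simp add: x y mu nu iota kappa cmul_cls[OF U] hmul_hyp hints_growth_hyp[OF U])
  with decay dual_eq_an dual_n
  show "hmul U a n \<in> hints_growth_decay U \<theta> (cmul U \<mu> \<nu>) (cmul U \<iota> \<kappa>) \<iota> \<and>
      dual U \<theta> (hmul U a n) = hmul U a (dual U \<theta> n)"
    by (simp add: hints_growth_decay_def)
qed

end
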